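(* Let $X$ be a separable infinite-dimensional $F$-space and let $T_1,\dots,T_N$ be continuous linear operators on $X$. Assume that there exist a dense set $Y\subset X^N$, an increasing sequence of nonnegative integers $(n_k)_{k\geq0}$ with positive lower density, and maps $S_{n_k}:Y\to X$ ($k\ge 0$) such that, for all $y=(y_1,\dots,y_N)\in Y$, the following assumptions are satisfied: (C1) $\sum_{k=0}^{+\infty}S_{n_k}y$ converges unconditionally in $X$; (C2) for all $j=1,\dots,N$, $\sum_{l=0}^{+\infty}T_j^{n_k}S_{n_{k+l}}y$ converges unconditionally in $X$, uniformly in $k\in\mathbb N$; (C3) for all $j=1,\dots,N$, $\sum_{l=0}^{k}T_j^{n_k}S_{n_{k-l}}y$ converges unconditionally in $X$, uniformly in $k\in\mathbb N$; (C4) for all $j=1,\dots,N$, $T_j^{n_k}S_{n_k}y\to y_j$ as $k\to+\infty$. Then $T_1,\dots,T_N$ are disjointly frequently hypercyclic.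
   Context: $\|\cdot\|$ denotes an $F$-norm defining the topology of $X$. Given a family $(x_{n,k})_{n\in\mathbb N,k\in I}\subset X$, the series $\sum_n x_{n,k}$ are unconditionally convergent, uniformly in $k\in I$, if for any $\varepsilon>0$ there exists $M\geq1$ such that, for any $k\in I$ and any finite $F\subset[M,+\infty)$, $\left\|\sum_{n\in F}x_{n,k}\right\|\leq\varepsilon$. For finite sums $\sum_{l=0}^k x_{l,k}$ (as in (C3)) the terms with $l>k$ are taken to be $0$, i.e. the condition reads $\left\|\sum_{l\in F\cap[0,k]}x_{l,k}\right\|\le\varepsilon$. $T_1,\dots,T_N$ are disjointly frequently hypercyclic if there is $x\in X$ such that, for any nonempty open set $U\subset X^N$, the set $\{n\in\mathbb N:\ (T_1^n x,\dots,T_N^n x)\in U\}$ has positive lower density. The lower density of $A\subset\mathbb N$ is $\liminf_{n\to\infty}\frac1n\#(A\cap[1,n])$; a sequence $(n_k)$ has positive lower density if the set $\{n_k\}$ does. *)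

theory Defs
  imports "HOL-Analysis.Analysis"
begin

text \<open>
  The scalar type ranges over \<^class>\<open>real_normed_field\<close>; up to isomorphism the only
  instances are the real and the complex numbers. The topology of the space is that of the
  type class \<^class>\<open>complete_space\<close>, which \<open>dist_fnorm\<close> ties to the F-norm.
\<close>

locale F_space = vector_space scale
  for scale :: "'k::real_normed_field \<Rightarrow> 'a::{ab_group_add, complete_space} \<Rightarrow> 'a" +
  fixes fnorm :: "'a \<Rightarrow> real"
  assumes fnorm_nonneg: "0 \<le> fnorm x"
    and fnorm_eq_0D: "fnorm x = 0 \<Longrightarrow> x = 0"
    and fnorm_triangle: "fnorm (x + y) \<le> fnorm x + fnorm y"
    and fnorm_scale_le: "norm c \<le> 1 \<Longrightarrow> fnorm (scale c x) \<le> fnorm x"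
    and fnorm_scale_tendsto_0: "((\<lambda>c. fnorm (scale c x)) \<longlongrightarrow> 0) (at 0)"
    and dist_fnorm: "dist x y = fnorm (x - y)"

definition uncond_convergent_uniformly ::
    "('a::ab_group_add \<Rightarrow> real) \<Rightarrow> 'i set \<Rightarrow> (nat \<Rightarrow> 'i \<Rightarrow> 'a) \<Rightarrow> bool" where
  "uncond_convergent_uniformly fnorm I x \<longleftrightarrow>
    (\<forall>\<epsilon>>0. \<exists>M\<ge>1. \<forall>k\<in>I. \<forall>F. finite F \<and> F \<subseteq> {M..} \<longrightarrow> fnorm (\<Sum>n\<in>F. x n k) \<le> \<epsilon>)"

definition lower_density :: "nat set \<Rightarrow> ereal" where
  "lower_density A = liminf (\<lambda>n. ereal (real (card (A \<inter> {1..n})) / real n))"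

definition disjointly_frequently_hypercyclic ::
    "('n::finite \<Rightarrow> 'a::topological_space \<Rightarrow> 'a) \<Rightarrow> bool" where
  "disjointly_frequently_hypercyclic T \<longleftrightarrow>
    (\<exists>x. \<forall>U :: ('a ^ 'n) set. open U \<and> U \<noteq> {} \<longrightarrow>
      0 < lower_density {n. (\<chi> j. (T j ^^ n) x) \<in> U})"

lemma F_space_banach: "F_space (scaleR :: real \<Rightarrow> 'a \<Rightarrow> 'a::banach) norm"
proof -
  interpret vector_space "scaleR :: real \<Rightarrow> 'a \<Rightarrow> 'a"
    by unfold_locales (simp_all add: scaleR_add_right scaleR_add_left)
  show ?thesis
  proof unfold_locales
    fix c :: real and x :: 'a
    assume "norm c \<le> 1"
    then show "norm (c *\<^sub>R x) \<le> norm x"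
      by (simp add: mult_left_le_one_le)
  next
    fix x :: 'a
    have "((\<lambda>c. norm (c *\<^sub>R x)) \<longlongrightarrow> norm (0 *\<^sub>R x)) (at (0::real))"
      by (intro tendsto_intros)
    then show "((\<lambda>c. norm (c *\<^sub>R x)) \<longlongrightarrow> 0) (at (0::real))" by simp
  qed (simp_all add: norm_triangle_ineq dist_norm)
qed

text \<open>
  For a single series in an F-space, the uniform Cauchy criterion over a one-element index set
  agrees with the library's unconditional convergence.
\<close>

lemma (in F_space) summable_on_iff_uncond_convergent_uniformly:
  fixes x :: "nat \<Rightarrow> 'a"
  shows "x summable_on UNIV \<longleftrightarrow> uncond_convergent_uniformly fnorm {()} (\<lambda>n _. x n)"
proof
  have sum_diff: "sum x (A \<union> B) - sum x A = sum x B"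
    if "finite A" "finite B" "A \<inter> B = {}" for A B
    using that by (simp add: sum.union_disjoint)
  {
    assume "x summable_on UNIV"
    then obtain s where s: "(sum x \<longlongrightarrow> s) (finite_subsets_at_top UNIV)"
      by (auto simp: summable_on_def has_sum_def)
    show "uncond_convergent_uniformly fnorm {()} (\<lambda>n _. x n)"
      unfolding uncond_convergent_uniformly_def
    proof (intro allI impI)
      fix e :: real
      assume "e > 0"
      then have "\<forall>\<^sub>F A in finite_subsets_at_top UNIV. dist (sum x A) s < e / 2"
        using s by (auto dest!: tendstoD[where e = "e/2"])
      then obtain A where A: "finite A" "\<And>B. finite B \<Longrightarrow> A \<subseteq> B \<Longrightarrow> dist (sum x B) s < e / 2"
        by (auto simp: eventually_finite_subsets_at_top)
      obtain M where M: "\<forall>a\<in>A. a < M" using A(1) finite_nat_set_iff_bounded by auto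
      have "fnorm (sum x F) \<le> e" if F: "finite F" "F \<subseteq> {max M 1..}" for F
      proof -
        have "A \<inter> F = {}" using M F(2) by fastforce
        then have "fnorm (sum x F) = dist (sum x (A \<union> F)) (sum x A)"
          using sum_diff A(1) F(1) by (simp add: dist_fnorm)
        also have "\<dots> \<le> dist (sum x (A \<union> F)) s + dist (sum x A) s"
          by (rule dist_triangle2)
        also have "\<dots> < e" using A(2)[of "A \<union> F"] A(2)[of A] A(1) F(1) by auto
        finally show ?thesis by simp
      qed
      then show "\<exists>M\<ge>1. \<forall>k\<in>{()}. \<forall>F. finite F \<and> F \<subseteq> {M..} \<longrightarrow> fnorm (\<Sum>n\<in>F. x n) \<le> e"
        by (intro exI[of _ "max M 1"]) auto
    qed
  }
  {
    assume u: "uncond_convergent_uniformly fnorm {()} (\<lambda>n _. x n)"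
    have tail: "\<exists>M. \<forall>F. finite F \<and> F \<subseteq> {M..} \<longrightarrow> fnorm (sum x F) \<le> e" if "e > 0" for e
      using u that unfolding uncond_convergent_uniformly_def by (metis insertI1)
    have close: "\<exists>M. \<forall>m\<ge>M. \<forall>B. finite B \<and> {..<m} \<subseteq> B \<longrightarrow> dist (sum x B) (sum x {..<m}) \<le> e"
      if e: "e > 0" for e
    proof -
      obtain M where M: "\<And>F. finite F \<Longrightarrow> F \<subseteq> {M..} \<Longrightarrow> fnorm (sum x F) \<le> e"
        using tail[OF e] by blast
      have "dist (sum x B) (sum x {..<m}) \<le> e"
        if "m \<ge> M" "finite B" "{..<m} \<subseteq> B" for m B
      proof -
        have "{..<m} \<union> (B - {..<m}) = B" using that(3) by auto
        then have "sum x B - sum x {..<m} = sum x (B - {..<m})"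
          using sum_diff[of "{..<m}" "B - {..<m}"] that(2) by auto
        moreover have "fnorm (sum x (B - {..<m})) \<le> e"
          by (rule M) (use that in auto)
        ultimately show ?thesis by (simp add: dist_fnorm)
      qed
      then show ?thesis by blast
    qed
    have "Cauchy (\<lambda>m. sum x {..<m})"
      unfolding Cauchy_altdef2
    proof (intro allI impI)
      fix e :: real
      assume "e > 0"
      then obtain M where M: "\<And>m B. m \<ge> M \<Longrightarrow> finite B \<Longrightarrow> {..<m} \<subseteq> B
          \<Longrightarrow> dist (sum x B) (sum x {..<m}) \<le> e / 2"
        using close[of "e/2"] by auto
      have "dist (sum x {..<m}) (sum x {..<M}) < e" if "m \<ge> M" for m
        using M[of M "{..<m}"] that \<open>e > 0\<close> by fastforce
      then show "\<exists>N. \<forall>m\<ge>N. dist (sum x {..<m}) (sum x {..<N}) < e" by blast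
    qed
    then obtain s where s: "(\<lambda>m. sum x {..<m}) \<longlonglongrightarrow> s"
      using Cauchy_convergent_iff convergent_def by blast
    have "(sum x \<longlongrightarrow> s) (finite_subsets_at_top UNIV)"
    proof (rule tendstoI)
      fix e :: real
      assume "e > 0"
      then obtain M where M: "\<And>m B. m \<ge> M \<Longrightarrow> finite B \<Longrightarrow> {..<m} \<subseteq> B
          \<Longrightarrow> dist (sum x B) (sum x {..<m}) \<le> e / 2"
        using close[of "e/2"] by auto
      obtain K where K: "\<And>m. m \<ge> K \<Longrightarrow> dist (sum x {..<m}) s < e / 2"
        using s \<open>e > 0\<close> by (meson half_gt_zero lim_sequentially)
      define m where "m = max M K"
      have "dist (sum x B) s < e" if "finite B" "{..<m} \<subseteq> B" for B
      proof -
        have "dist (sum x B) s \<le> dist (sum x B) (sum x {..<m}) + dist (sum x {..<m}) s"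
          by (rule dist_triangle)
        then show ?thesis using M[of m B] K[of m] that by (simp add: m_def)
      qed
      then show "\<forall>\<^sub>F B in finite_subsets_at_top UNIV. dist (sum x B) s < e"
        unfolding eventually_finite_subsets_at_top by (intro exI[of _ "{..<m}"]) auto
    qed
    then show "x summable_on UNIV" by (auto simp: summable_on_def has_sum_def)
  }
qed

end

theory Submission
  imports Defs "HOL-Computational_Algebra.Primes"
begin

text \<open>
  Let \<open>y\<^sub>p\<close> run through a countable dense part of \<open>Y\<close>, each point occurring infinitely often.
  Choose indices \<open>i\<^sub>0 < i\<^sub>1 < \<dots>\<close> of linear growth, each carrying a colour \<open>p\<close>, so that every colour
  occurs along a subsequence of linear growth, while indices of colours \<open>l\<close> and \<open>p\<close> are at least
  \<open>N\<^sub>l + N\<^sub>p\<close> apart. Let \<open>x\<close> be the sum of \<open>S\<^bsub>n\<^esub> y\<^sub>p\<close> over \<open>n = n\<^sub>i\<close>, where \<open>i\<close> runs through the chosen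
  indices and \<open>p\<close> is its colour. If \<open>k\<close> has colour \<open>p\<close> and \<open>n = n\<^sub>k\<close>, then \<open>T\<^sub>j\<^sup>n x\<close> is close to the
  \<open>j\<close>-th coordinate of \<open>y\<^sub>p\<close>: the summand at \<open>k\<close> gives this coordinate by (C4), and the terms of
  colour \<open>l\<close> above and below \<open>k\<close> are tails in (C2) and (C3), of size at most
  \<open>1/4\<close> to the power \<open>max l p\<close>, hence at most \<open>1/2\<close> to the power \<open>l + p\<close>, if \<open>N\<close> grows fast enough.
\<close>

section \<open>Sets of positive lower density\<close>

text \<open>At most \<open>k + 1\<close> values of \<open>n\<close> lie in \<open>{1..n k}\<close>,
  so a density above \<open>d\<close> forces \<open>d * n k < k + 1\<close> once \<open>n k\<close>
  is large.\<close>

lemma linear_growth_of_lower_density_pos: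
  fixes n :: "nat \<Rightarrow> nat"
  assumes "strict_mono n" and "0 < lower_density (range n)"
  shows "\<exists>C. \<forall>k. n k \<le> C * Suc k"
proof -
  obtain d where d: "0 < d" "ereal d < lower_density (range n)"
    using assms(2) by (metis ereal_dense2 ereal_less(2))
  then have "\<forall>\<^sub>F m in sequentially. d < real (card (range n \<inter> {1..m})) / real m"
    unfolding lower_density_def by (auto dest!: less_LiminfD)
  then obtain M where M: "\<And>m. m \<ge> M \<Longrightarrow> d < real (card (range n \<inter> {1..m})) / real m"
    unfolding eventually_sequentially by blast
  define C where "C = max M (nat \<lceil>1 / d\<rceil>)"
  have "n k \<le> C * Suc k" for k
  proof (cases "n k \<le> M")
    case True
    then have "n k \<le> C" by (simp add: C_def)
    then show ?thesis by (metis le_trans mult.commute mult_Suc le_add1)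
  next
    case False
    have "range n \<inter> {1..n k} \<subseteq> n ` {..k}"
      using assms(1) by (auto simp: strict_mono_less_eq)
    then have "card (range n \<inter> {1..n k}) \<le> card (n ` {..k})"
      by (intro card_mono) auto
    also have "\<dots> \<le> Suc k"
      using card_image_le[of "{..k}" n] by simp
    finally have "real (card (range n \<inter> {1..n k})) \<le> real (Suc k)"
      by (rule of_nat_mono)
    moreover have "d * real (n k) < real (card (range n \<inter> {1..n k}))"
      using M[of "n k"] False by (simp add: field_simps)
    ultimately have "real (n k) \<le> 1 / d * real (Suc k)"
      using d(1) by (simp add: field_simps)
    also have "\<dots> \<le> real C * real (Suc k)"
      using of_nat_ceiling[of "1 / d"] by (intro mult_right_mono) (auto simp: C_def)
    finally show ?thesis
      by (metis of_nat_le_iff of_nat_mult)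
  qed
  then show ?thesis by blast
qed

text \<open>Indices below \<open>m div C\<close> have values at most \<open>m\<close>, so
  \<open>A\<close> has about \<open>m / C\<close> elements up to \<open>m\<close>; for
  \<open>m \<ge> 4 * C\<close> a factor 2 absorbs the rounding.\<close>

lemma lower_density_pos_of_linear_growth:
  fixes f :: "nat \<Rightarrow> nat"
  assumes f: "strict_mono f" and lin: "\<And>q. f q \<le> C * Suc q" and A: "range f \<subseteq> A"
  shows "0 < lower_density A"
proof -
  have C: "C > 0"
    using lin[of 1] strict_mono_imp_increasing[OF f, of 1] by (cases C) auto
  have bound: "ereal (1 / (2 * C)) \<le> ereal (real (card (A \<inter> {1..m})) / real m)"
    if m: "m \<ge> 4 * C" for m
  proof -
    \<comment> \<open>Index 0 is left out because \<open>f 0\<close> may be 0, which the count over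
      \<open>{1..m}\<close> ignores.\<close>
    have "f ` {1..<m div C} \<subseteq> A \<inter> {1..m}"
    proof
      fix y assume "y \<in> f ` {1..<m div C}"
      then obtain q where q: "1 \<le> q" "q < m div C" "y = f q" by auto
      have "C * Suc q \<le> C * (m div C)" using q(2) by (intro mult_le_mono) auto
      also have "\<dots> \<le> m" by simp
      finally have "f q \<le> m" using lin[of q] by linarith
      moreover have "1 \<le> f q"
        using q(1) strict_mono_imp_increasing[OF f, of q] by linarith
      ultimately show "y \<in> A \<inter> {1..m}" using q(3) A by auto
    qed
    then have "card (f ` {1..<m div C}) \<le> card (A \<inter> {1..m})" by (intro card_mono) auto
    moreover have "card (f ` {1..<m div C}) = m div C - 1"
      using f by (subst card_image) (auto simp: strict_mono_imp_inj_on inj_on_subset)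
    ultimately have card: "m div C \<le> card (A \<inter> {1..m}) + 1" by linarith
    have "m < C * (m div C) + C"
      using C by (metis add_strict_left_mono mod_less_divisor mult_div_mod_eq)
    also have "\<dots> \<le> C * (card (A \<inter> {1..m}) + 1) + C"
      using card by (intro add_right_mono mult_le_mono2)
    finally have "m \<le> C * card (A \<inter> {1..m}) + 2 * C" by simp
    then have "m \<le> 2 * (C * card (A \<inter> {1..m}))" using m by linarith
    then have "real m \<le> real (2 * (C * card (A \<inter> {1..m})))" by (rule of_nat_mono)
    moreover have "m > 0" using m C by linarith
    ultimately show ?thesis using C by (simp add: field_simps)
  qed
  have "ereal (1 / (2 * C)) \<le> lower_density A"
    unfolding lower_density_def
    by (rule Liminf_bounded) (use bound in \<open>auto simp: eventually_sequentially\<close>)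
  moreover have "0 < ereal (1 / (2 * C))" using C by simp
  ultimately show ?thesis by (rule less_le_trans[rotated])
qed

section \<open>Separated positions\<close>

text \<open>The sum is the exponent of 2 in \<open>s!\<close>. Odd \<open>t\<close> contribute 0 and
  \<open>t = 2 * u\<close> contributes one more than \<open>u\<close>, so induction through
  \<open>s div 2\<close> gives the bound.\<close>

lemma sum_multiplicity_2_le: "(\<Sum>t = 1..s. multiplicity 2 t) \<le> (s::nat)"
proof (induction s rule: less_induct)
  case (less s)
  show ?case
  proof (cases "s = 0")
    case False
    define m where "m = s div 2"
    have "(\<Sum>t = 1..s. multiplicity 2 t) = (\<Sum>t \<in> (*) 2 ` {1..m}. multiplicity 2 t)"
    proof (rule sum.mono_neutral_right)
      show "\<forall>t \<in> {1..s} - (*) 2 ` {1..m}. multiplicity 2 t = 0"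
      proof
        fix t assume t: "t \<in> {1..s} - (*) 2 ` {1..m}"
        have "odd t"
        proof
          assume "even t"
          then obtain u where "t = 2 * u" by (elim evenE)
          with t show False by (auto simp: m_def)
        qed
        then show "multiplicity 2 t = 0" by (rule not_dvd_imp_multiplicity_0)
      qed
    qed (auto simp: m_def)
    also have "\<dots> = (\<Sum>u = 1..m. multiplicity 2 (2 * u))"
      by (subst sum.reindex) (auto simp: inj_on_def)
    also have "\<dots> = (\<Sum>u = 1..m. Suc (multiplicity 2 u))"
      by (intro sum.cong refl multiplicity_times_same) auto
    also have "\<dots> = m + (\<Sum>u = 1..m. multiplicity 2 u)"
      by (simp add: sum_Suc)
    also have "\<dots> \<le> m + m"
      using less.IH[of m] False by (simp add: m_def)
    also have "\<dots> \<le> s" by (simp add: m_def)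
    finally show ?thesis .
  qed simp
qed

text \<open>A colour determined by the 2-adic valuation of \<open>s + 1\<close> recurs along an
  arithmetic progression, so every one of the infinitely many colours returns at linear
  rate.\<close>

lemma exists_separated_positions:
  fixes N :: "nat \<Rightarrow> nat"
  assumes pos: "\<And>p. N p > 0"
  obtains position colour :: "nat \<Rightarrow> nat" and C :: nat
  where "strict_mono position"
    and "\<And>s. N (colour s) \<le> position s"
    and "\<And>s t. s < t \<Longrightarrow> position s + N (colour s) + N (colour t) \<le> position t"
    and "\<And>s. position s \<le> C * Suc s"
    and "\<And>p. \<exists>f D. strict_mono f \<and> (\<forall>q. colour (f q) = p \<and> f q \<le> D * Suc q)"
proof -
  \<comment> \<open>Since \<open>N (\<phi> v) \<le> N 0 + v\<close> and the 2-adic valuations of \<open>1, \<dots>, s\<close> add up to at most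
    \<open>s\<close>, the total gap up to stage \<open>s\<close> is linear in \<open>s\<close> however fast \<open>N\<close> grows.\<close>
  define \<phi> where
    "\<phi> v = (let p = fst (prod_decode v) in if N p \<le> N 0 + v then p else 0)" for v
  define colour where "colour s = \<phi> (multiplicity 2 (Suc s))" for s
  \<comment> \<open>Stage \<open>s\<close> owns a block of length \<open>2 * N (colour s)\<close>
    starting at \<open>w s\<close>, with \<open>position s\<close> at its midpoint; this yields the
    margin on both sides.\<close>
  define w where "w s = 2 * (\<Sum>t<s. N (colour t))" for s
  define position where "position s = w s + N (colour s)" for s
  have \<phi>_le: "N (\<phi> v) \<le> N 0 + v" for v
    by (simp add: \<phi>_def Let_def)
  have w_Suc: "w (Suc s) = w s + 2 * N (colour s)" for s
    by (simp add: w_def)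
  have w_mono: "w s \<le> w t" if "s \<le> t" for s t
    using lift_Suc_mono_le[of w s t] that by (simp add: w_Suc)
  have sep: "position s + N (colour s) + N (colour t) \<le> position t" if "s < t" for s t
    using w_mono[of "Suc s" t] that by (simp add: w_Suc position_def)
  show thesis
  proof (rule that)
    show "strict_mono position"
    proof (rule strict_monoI)
      fix s t :: nat assume "s < t"
      then show "position s < position t"
        using sep[of s t] pos[of "colour s"] by linarith
    qed
    show "N (colour s) \<le> position s" for s by (simp add: position_def)
    show "position s + N (colour s) + N (colour t) \<le> position t" if "s < t" for s t
      using that by (rule sep)
    show "position s \<le> (2 * (N 0 + 1)) * Suc s" for s
    proof -
      have "position s \<le> w (Suc s)" by (simp add: position_def w_Suc)
      also have "\<dots> \<le> 2 * (\<Sum>t<Suc s. N 0 + multiplicity 2 (Suc t))"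
        unfolding w_def colour_def by (intro mult_le_mono2 sum_mono \<phi>_le)
      also have "(\<Sum>t<Suc s. N 0 + multiplicity 2 (Suc t))
          = Suc s * N 0 + (\<Sum>t = 1..Suc s. multiplicity 2 t)"
        by (simp add: sum.distrib sum.atLeast1_atMost_eq)
      also have "2 * \<dots> \<le> 2 * (Suc s * N 0 + Suc s)"
        by (intro mult_le_mono2 add_left_mono sum_multiplicity_2_le)
      finally show ?thesis by (simp add: algebra_simps)
    qed
    show "\<exists>f D. strict_mono f \<and> (\<forall>q. colour (f q) = p \<and> f q \<le> D * Suc q)" for p
    proof -
      \<comment> \<open>Encoding \<open>N p\<close> along with \<open>p\<close> makes
        \<open>v\<close> large enough to pass the test in \<open>\<phi>\<close>, so colour
        \<open>p\<close> is not replaced by the default 0.\<close>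
      define v where "v = prod_encode (p, N p)"
      have "N p \<le> v" unfolding v_def by (rule le_prod_encode_2)
      then have \<phi>v: "\<phi> v = p" by (simp add: \<phi>_def v_def)
      \<comment> \<open>These are the stages \<open>s\<close> with \<open>s + 1\<close> of valuation
        exactly \<open>v\<close>; subtracting 1 undoes the shift in \<open>colour\<close>.\<close>
      define f :: "nat \<Rightarrow> nat" where "f q = 2 ^ v * (2 * q + 1) - 1" for q
      have Suc_f: "Suc (f q) = 2 ^ v * (2 * q + 1)" for q by (simp add: f_def)
      have "strict_mono f"
      proof (rule strict_monoI)
        fix a b :: nat assume "a < b"
        then have "Suc (f a) < Suc (f b)" unfolding Suc_f by simp
        then show "f a < f b" by simp
      qed
      moreover have "colour (f q) = p" for q
      proof -
        have "multiplicity 2 (Suc (f q)) = v" unfolding Suc_f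
          by (rule multiplicity_decomposeI[OF refl]) auto
        then show ?thesis by (simp add: colour_def \<phi>v)
      qed
      moreover have "f q \<le> 2 ^ Suc v * Suc q" for q
      proof -
        have "f q \<le> 2 ^ v * (2 * q + 1)" using Suc_f[of q] by linarith
        also have "\<dots> \<le> 2 ^ v * (2 * Suc q)" by simp
        finally show ?thesis by (simp add: mult.assoc mult.left_commute)
      qed
      ultimately show ?thesis by blast
    qed
  qed
qed

section \<open>Dense sequences in finite powers\<close>

text \<open>\<open>Y\<close> may miss every vector with entries in a given countable dense set, so
  each such vector is approximated from within \<open>Y\<close> at every scale
  \<open>1 / (m + 1)\<close>.\<close>

lemma exists_dense_sequence_in:
  fixes Y :: "('a::metric_space ^ 'n::finite) set"
  assumes sep: "separable_space (euclidean :: 'a topology)" and dense: "closure Y = UNIV"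
  obtains y :: "nat \<Rightarrow> 'a ^ 'n" where "range y \<subseteq> Y"
    and "\<And>U. open U \<Longrightarrow> U \<noteq> {} \<Longrightarrow> \<exists>i. y i \<in> U"
proof -
  obtain D :: "'a set" where D: "countable D" "closure D = UNIV"
    using sep by (auto simp: separable_space_def euclidean_closure_of)
  define E where "E = {v :: 'a ^ 'n. \<forall>i. v $ i \<in> D}"
  have cE: "countable E" unfolding E_def by (rule countable_vector) (rule D)
  have "\<forall>v m. \<exists>y\<in>Y. dist y v < inverse (real (Suc m))"
    using dense closure_approachable[of _ Y] by auto
  then obtain g where g: "\<And>v m. g v m \<in> Y" "\<And>v m. dist (g v m) v < inverse (real (Suc m))"
    by metis
  define Z where "Z = (\<lambda>(v, m). g v m) ` (E \<times> UNIV)"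
  have Z: "countable Z" unfolding Z_def using cE by (intro countable_image countable_SIGMA) auto
  have dense_Z: "\<exists>z\<in>Z. z \<in> U" if U: "open U" "U \<noteq> {}" for U
  proof -
    obtain u r where r: "r > 0" "ball u r \<subseteq> U" 
      using U by (metis all_not_in_conv open_contains_ball)
    \<comment> \<open>Coordinate errors below \<open>e\<close> add up to less than
      \<open>r / 2\<close>; the other half is for the step from \<open>v\<close> to
      \<open>g v m\<close>.\<close>
    define e where "e = r / (2 * (real CARD('n) + 1))"
    have e: "e > 0" using r(1) by (simp add: e_def field_simps add_pos_nonneg)
    have "\<forall>i. \<exists>d\<in>D. dist d (u $ i) < e"
      using D(2) e closure_approachable[of _ D] by auto
    then obtain d where d: "\<And>i. d i \<in> D" "\<And>i. dist (d i) (u $ i) < e" by metis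
    define v where "v = (\<chi> i. d i)"
    have "v \<in> E" using d(1) by (simp add: v_def E_def)
    have "dist v u \<le> (\<Sum>i\<in>UNIV. dist (v $ i) (u $ i))"
      unfolding dist_vec_def by (rule L2_set_le_sum) simp
    also have "\<dots> \<le> real CARD('n) * e"
      using sum_bounded_above[of UNIV "\<lambda>i. dist (v $ i) (u $ i)" e] d(2)
      by (simp add: v_def less_imp_le)
    also have "\<dots> < r / 2"
      using r(1) by (simp add: e_def field_simps)
    finally have vu: "dist v u < r / 2" .
    obtain m where m: "inverse (real (Suc m)) < r / 2"
      using reals_Archimedean[of "r / 2"] r(1) by auto
    have "dist u (g v m) \<le> dist u v + dist v (g v m)" by (rule dist_triangle)
    then have "dist u (g v m) < r"
      using vu m g(2)[of v m] by (simp add: dist_commute)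
    then have "g v m \<in> U" using r(2) by auto
    moreover have "g v m \<in> Z" using \<open>v \<in> E\<close> by (auto simp: Z_def)
    ultimately show ?thesis by blast
  qed
  have "Z \<noteq> {}" using dense_Z[of UNIV] by auto
  then have rng: "range (from_nat_into Z) = Z" using Z by (rule range_from_nat_into)
  show thesis
  proof (rule that)
    show "range (from_nat_into Z) \<subseteq> Y" unfolding rng using g(1) by (auto simp: Z_def)
    show "\<exists>i. from_nat_into Z i \<in> U" if "open U" "U \<noteq> {}" for U
      using dense_Z[OF that] rng by (metis rangeE)
  qed
qed


section \<open>Sums in F-spaces\<close>

context F_space
begin

lemma fnorm_zero: "fnorm 0 = 0"
  using dist_fnorm[of 0 0] by simp

lemma fnorm_sum_le: "fnorm (sum g A) \<le> (\<Sum>i\<in>A. fnorm (g i))"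
proof (induction A rule: infinite_finite_induct)
  case (insert a A)
  then show ?case using fnorm_triangle[of "g a" "sum g A"] by simp
qed (simp_all add: fnorm_zero)

text \<open>Since \<open>l + p \<le> 2 * max l p\<close>, colour \<open>l\<close> contributes at
  most \<open>(1/2) ^ (l + p)\<close>, and the powers \<open>(1/2) ^ l\<close> add up to at most
  2.\<close>

lemma fnorm_sum_coloured_le:
  fixes c :: "'i \<Rightarrow> nat"
  assumes F: "finite F"
    and bound: "\<And>l. fnorm (\<Sum>s\<in>{s\<in>F. c s = l}. g s) \<le> (1/4) ^ max l p"
  shows "fnorm (sum g F) \<le> 2 * (1/2) ^ p"
proof -
  have geometric: "(\<Sum>l\<in>c ` F. (1/2::real) ^ l) \<le> 2"
    using sum_le_suminf[OF summable_geometric[of "1/2::real"], of "c ` F"] F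
    by (simp add: suminf_geometric)
  have power: "(1/4::real) ^ max l p \<le> (1/2) ^ l * (1/2) ^ p" for l
  proof -
    have "(1/4::real) ^ max l p = (1/2) ^ (2 * max l p)"
      by (simp add: power_mult power2_eq_square)
    also have "\<dots> \<le> (1/2) ^ (l + p)" by (rule power_decreasing) auto
    finally show ?thesis by (simp add: power_add)
  qed
  have "sum g F = (\<Sum>l\<in>c ` F. \<Sum>s\<in>{s\<in>F. c s = l}. g s)"
    using F by (intro sum.group[symmetric]) auto
  then have "fnorm (sum g F) \<le> (\<Sum>l\<in>c ` F. fnorm (\<Sum>s\<in>{s\<in>F. c s = l}. g s))"
    using fnorm_sum_le by simp
  also have "\<dots> \<le> (\<Sum>l\<in>c ` F. (1/2) ^ l * (1/2) ^ p)"
    using bound power by (intro sum_mono) (meson order_trans)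
  also have "\<dots> = (\<Sum>l\<in>c ` F. (1/2) ^ l) * (1/2) ^ p"
    by (simp add: sum_distrib_right)
  also have "\<dots> \<le> 2 * (1/2) ^ p"
    using geometric by (intro mult_right_mono) auto
  finally show ?thesis .
qed

lemma linear_funpow_sum:
  assumes "Vector_Spaces.linear scale scale f"
  shows "(f ^^ k) (sum g A) = (\<Sum>i\<in>A. (f ^^ k) (g i))"
proof (induction k)
  case (Suc k)
  interpret f: Vector_Spaces.linear scale scale f by fact
  show ?case by (simp add: Suc f.sum)
qed simp

end

text \<open>A threshold may be enlarged freely; the eventual form lets finitely many conditions
  share one threshold.\<close>

lemma eventually_uncond_convergent_uniformly:
  assumes "uncond_convergent_uniformly N I x" and "e > 0"
  shows "\<forall>\<^sub>F M in sequentially.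
    \<forall>k\<in>I. \<forall>F. finite F \<longrightarrow> F \<subseteq> {M..} \<longrightarrow> N (\<Sum>i\<in>F. x i k) \<le> e"
proof -
  obtain M where M: "\<forall>k\<in>I. \<forall>F. finite F \<and> F \<subseteq> {M..} \<longrightarrow> N (\<Sum>i\<in>F. x i k) \<le> e"
    using assms unfolding uncond_convergent_uniformly_def by blast
  show ?thesis
    unfolding eventually_sequentially
  proof (intro exI[of _ M] allI ballI impI)
    fix m k F
    assume "M \<le> m" "k \<in> I" "finite F" "F \<subseteq> {m..}"
    moreover from this have "F \<subseteq> {M..}" by auto
    ultimately show "N (\<Sum>i\<in>F. x i k) \<le> e" using M by simp
  qed
qed

lemma continuous_on_funpow:
  fixes f :: "'a::topological_space \<Rightarrow> 'a"
  assumes "continuous_on UNIV f"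
  shows "continuous_on UNIV (f ^^ k)"
proof (induction k)
  case (Suc k)
  show ?case
    unfolding funpow.simps
    by (rule continuous_on_compose[OF Suc continuous_on_subset[OF assms]]) simp
qed (simp add: continuous_on_id)

section \<open>The criterion\<close>

theorem theorem2p1:
  fixes scale :: "'k::real_normed_field \<Rightarrow> 'a::{ab_group_add, complete_space} \<Rightarrow> 'a"
    and fnorm :: "'a \<Rightarrow> real"
    and T :: "'n::finite \<Rightarrow> 'a \<Rightarrow> 'a"
    and Y :: "('a ^ 'n) set"
    and n :: "nat \<Rightarrow> nat"
    and S :: "nat \<Rightarrow> 'a ^ 'n \<Rightarrow> 'a"
  assumes F_space: "F_space scale fnorm"
    and separable: "separable_space (euclidean :: 'a topology)"
    and infinite_dim: "\<nexists>B. finite B \<and> module.span scale B = UNIV"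
    and linear: "\<And>j. Vector_Spaces.linear scale scale (T j)"
    and continuous: "\<And>j. continuous_on UNIV (T j)"
    and dense: "closure Y = UNIV"
    and increasing: "strict_mono n"
    and density: "0 < lower_density (range n)"
    and C1: "\<And>y. y \<in> Y \<Longrightarrow> (\<lambda>k. S (n k) y) summable_on UNIV"
    and C2: "\<And>y j. y \<in> Y \<Longrightarrow> uncond_convergent_uniformly fnorm UNIV
               (\<lambda>l k. (T j ^^ n k) (S (n (k + l)) y))"
    and C3: "\<And>y j. y \<in> Y \<Longrightarrow> uncond_convergent_uniformly fnorm UNIV
               (\<lambda>l k. if l \<le> k then (T j ^^ n k) (S (n (k - l)) y) else 0)"
    and C4: "\<And>y j. y \<in> Y \<Longrightarrow> (\<lambda>k. (T j ^^ n k) (S (n k) y)) \<longlonglongrightarrow> y $ j"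
  shows "disjointly_frequently_hypercyclic T"
proof -
  interpret F_space scale fnorm by (rule F_space)
  obtain y0 :: "nat \<Rightarrow> 'a ^ 'n" where y0: "range y0 \<subseteq> Y"
    and y0_dense: "\<And>U. open U \<Longrightarrow> U \<noteq> {} \<Longrightarrow> \<exists>i. y0 i \<in> U"
    using exists_dense_sequence_in[OF separable dense] by metis
  \<comment> \<open>Every point is repeated for arbitrarily large indices \<open>p\<close>, where the error bound is small.\<close>
  define y where "y p = y0 (fst (prod_decode p))" for p
  have yY: "y p \<in> Y" for p using y0 by (auto simp: y_def)
  \<comment> \<open>The four clauses are quantitative forms of (C1), (C2), (C3) and (C4), so that
    one \<open>M\<close> can serve as threshold for all of them.\<close>
  define small where "small q M m \<longleftrightarrow>
    (\<forall>F. finite F \<longrightarrow> F \<subseteq> {M..} \<longrightarrow> fnorm (\<Sum>i\<in>F. S (n i) (y m)) \<le> (1/4) ^ q) \<and>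
    (\<forall>j. (\<forall>k F. finite F \<longrightarrow> F \<subseteq> {M..} \<longrightarrow>
             fnorm (\<Sum>l\<in>F. (T j ^^ n k) (S (n (k + l)) (y m))) \<le> (1/4) ^ q) \<and>
         (\<forall>k F. finite F \<longrightarrow> F \<subseteq> {M..} \<longrightarrow>
             fnorm (\<Sum>l\<in>F. if l \<le> k then (T j ^^ n k) (S (n (k - l)) (y m)) else 0) \<le> (1/4) ^ q) \<and>
         (\<forall>k\<ge>M. dist ((T j ^^ n k) (S (n k) (y m))) (y m $ j) < (1/4) ^ q))" for q M m
  have ev: "\<forall>\<^sub>F M in sequentially. small q M m" for q m
  proof -
    have q: "(0::real) < (1/4) ^ q" by simp
    have *: "\<forall>\<^sub>F M in sequentially. \<forall>k\<ge>M. dist ((T j ^^ n k) (S (n k) (y m))) (y m $ j) < (1/4) ^ q"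
      for j
      using tendstoD[OF C4[OF yY[of m], of j] q]
      by (rule eventually_all_ge_at_top)
    have **: "uncond_convergent_uniformly fnorm {()} (\<lambda>k _. S (n k) (y m))"
      using C1[OF yY] by (simp add: summable_on_iff_uncond_convergent_uniformly)
    show ?thesis unfolding small_def
      using eventually_uncond_convergent_uniformly[OF ** q]
        eventually_uncond_convergent_uniformly[OF C2[OF yY] q]
        eventually_uncond_convergent_uniformly[OF C3[OF yY] q] *
      by (intro eventually_conj eventually_all_finite) simp_all
  qed
  \<comment> \<open>The finitely many targets with \<open>m \<le> q\<close> share one threshold; for
    colours \<open>l\<close> and \<open>p\<close> it is used with
    \<open>q = max l p\<close>.\<close>
  have "\<exists>M>0. \<forall>m\<le>q. small q M m" for q
  proof -
    have "\<forall>\<^sub>F M in sequentially. \<forall>m\<in>{..q}. small q M m"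
      by (intro eventually_ball_finite ballI ev) auto
    then have "\<forall>\<^sub>F M in sequentially. 0 < M \<and> (\<forall>m\<in>{..q}. small q M m)"
      by (intro eventually_conj eventually_gt_at_top)
    then show ?thesis by (auto dest!: eventually_happens)
  qed
  then obtain N where N: "\<And>q. N q > 0" "\<And>q m. m \<le> q \<Longrightarrow> small q (N q) m"
    by metis
  obtain pos colour C where pos: "strict_mono pos"
    and N_le_pos: "\<And>s. N (colour s) \<le> pos s"
    and sep: "\<And>s t. s < t \<Longrightarrow> pos s + N (colour s) + N (colour t) \<le> pos t"
    and pos_le: "\<And>s. pos s \<le> C * Suc s"
    and fibre: "\<And>p. \<exists>f D. strict_mono f \<and> (\<forall>q. colour (f q) = p \<and> f q \<le> D * Suc q)"
    using exists_separated_positions[of N] N(1) by metis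
  \<comment> \<open>The separation of colours \<open>l\<close> and \<open>p\<close> therefore
    reaches the threshold for \<open>max l p\<close>.\<close>
  have N_max: "N (max l p) \<le> N l + N p" for l p by (simp add: max_def)
  have pos_inj: "inj_on pos G" for G
    using pos strict_mono_imp_inj_on inj_on_subset by blast
  define z where "z s = S (n (pos s)) (y (colour s))" for s

  \<comment> \<open>Convergence of the series defining \<open>x\<close>\<close>
  have tail: "fnorm (sum z F) \<le> 2 * (1/2) ^ p" if F: "finite F" "F \<subseteq> {N p..}" for F p
  proof (rule fnorm_sum_coloured_le[OF F(1)])
    fix l
    define G where "G = {s\<in>F. colour s = l}"
    have "(\<Sum>s\<in>G. z s) = (\<Sum>i\<in>pos ` G. S (n i) (y l))"
      by (subst sum.reindex[OF pos_inj]) (auto simp: z_def G_def)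
    \<comment> \<open>\<open>N l\<close> is reached since \<open>pos s\<close> is at least the
      threshold of its own colour, and \<open>N p\<close> since
      \<open>pos s \<ge> s\<close>.\<close>
    moreover have "pos ` G \<subseteq> {N (max l p)..}"
    proof -
      have "N (max l p) \<le> pos s" if "s \<in> G" for s
        using that F(2) N_le_pos[of s] strict_mono_imp_increasing[OF pos, of s]
        by (auto simp: G_def max_def)
      then show ?thesis by auto
    qed
    moreover have "finite (pos ` G)" using F(1) by (simp add: G_def)
    ultimately show "fnorm (\<Sum>s\<in>{s\<in>F. colour s = l}. z s) \<le> (1/4) ^ max l p"
      using N(2)[of l "max l p"] unfolding small_def G_def[symmetric] by simp
  qed
  have "uncond_convergent_uniformly fnorm {()} (\<lambda>s _. z s)"
    unfolding uncond_convergent_uniformly_def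
  proof (intro allI impI)
    fix e :: real assume "e > 0"
    then obtain p where p: "(1/2) ^ p < e / 2"
      using real_arch_pow_inv[of "e / 2" "1/2"] by auto
    have "fnorm (sum z F) \<le> e" if "finite F" "F \<subseteq> {N p..}" for F
      using tail[OF that] p by linarith
    then show "\<exists>M\<ge>1. \<forall>k\<in>{()}. \<forall>F. finite F \<and> F \<subseteq> {M..} \<longrightarrow> fnorm (sum z F) \<le> e"
      using N(1)[of p] by (intro exI[of _ "N p"]) auto
  qed
  then obtain x where "(z has_sum x) UNIV"
    unfolding summable_on_iff_uncond_convergent_uniformly[symmetric] summable_on_def by blast
  then have x: "(\<lambda>m. sum z {..<m}) \<longlonglongrightarrow> x"
    unfolding has_sum_def by (rule filterlim_compose[OF _ filterlim_lessThan_at_top])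

  \<comment> \<open>Approximation of the targets along the orbits of \<open>x\<close>\<close>
  have approx: "dist ((T j ^^ n (pos t)) x) (y (colour t) $ j) \<le> 5 * (1/2) ^ colour t" for j t
  proof -
    define k where "k = pos t"
    define p where "p = colour t"
    define A where "A = T j ^^ n k"
    have A_sum: "A (sum g F) = (\<Sum>i\<in>F. A (g i))" for g :: "nat \<Rightarrow> 'a" and F
      unfolding A_def by (rule linear_funpow_sum[OF linear])
    have after: "fnorm (\<Sum>s\<in>F. A (z s)) \<le> 2 * (1/2) ^ p" if F: "finite F" "F \<subseteq> {t<..}" for F
    proof (rule fnorm_sum_coloured_le[OF F(1)])
      fix l
      define G where "G = {s\<in>F. colour s = l}"
      \<comment> \<open>Subtracting \<open>k\<close> turns the later terms of colour
        \<open>l\<close> into part of a tail in (C2).\<close>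
      define d where "d s = pos s - k" for s
      have d: "pos s = k + d s" "N (max l p) \<le> d s" if "s \<in> G" for s
        using sep[of t s] that F(2) N_max[of l p] by (auto simp: G_def d_def k_def p_def)
      have "inj_on d G"
        using pos_inj[of G] d(1) by (metis inj_on_def)
      then have "(\<Sum>s\<in>G. A (z s)) = (\<Sum>i\<in>d ` G. A (S (n (k + i)) (y l)))"
        using d(1) by (subst sum.reindex) (auto simp: z_def G_def intro!: sum.cong)
      moreover have "d ` G \<subseteq> {N (max l p)..}" using d(2) by auto
      moreover have "finite (d ` G)" using F(1) by (simp add: G_def)
      ultimately show "fnorm (\<Sum>s\<in>{s\<in>F. colour s = l}. A (z s)) \<le> (1/4) ^ max l p"
        using N(2)[of l "max l p"] unfolding small_def G_def[symmetric] A_def by simp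
    qed
    have before: "fnorm (\<Sum>s\<in>F. A (z s)) \<le> 2 * (1/2) ^ p" if F: "finite F" "F \<subseteq> {..<t}" for F
    proof (rule fnorm_sum_coloured_le[OF F(1)])
      fix l
      define G where "G = {s\<in>F. colour s = l}"
      \<comment> \<open>Counting back from \<open>k\<close> gives part of a tail in (C3);
        \<open>d s \<le> k\<close> keeps clear of the default 0.\<close>
      define d where "d s = k - pos s" for s
      have d: "pos s = k - d s" "d s \<le> k" "N (max l p) \<le> d s" if "s \<in> G" for s
        using sep[of s t] that F(2) N_max[of l p] by (auto simp: G_def d_def k_def p_def)
      have "inj_on d G"
        using pos_inj[of G] d(1) by (metis inj_on_def)
      then have "(\<Sum>s\<in>G. A (z s)) =
          (\<Sum>i\<in>d ` G. if i \<le> k then A (S (n (k - i)) (y l)) else 0)"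
        using d(1,2) by (subst sum.reindex) (auto simp: z_def G_def intro!: sum.cong)
      moreover have "d ` G \<subseteq> {N (max l p)..}" using d(3) by auto
      moreover have "finite (d ` G)" using F(1) by (simp add: G_def)
      ultimately show "fnorm (\<Sum>s\<in>{s\<in>F. colour s = l}. A (z s)) \<le> (1/4) ^ max l p"
        using N(2)[of l "max l p"] unfolding small_def G_def[symmetric] A_def by simp
    qed
    have "dist (A (z t)) (y p $ j) < (1/4) ^ p"
      using N(2)[of p p] N_le_pos[of t] unfolding small_def A_def z_def k_def p_def by blast
    also have "(1/4::real) ^ p \<le> (1/2) ^ p" by (intro power_mono) auto
    finally have at: "fnorm (A (z t) - y p $ j) \<le> (1/2) ^ p" by (simp add: dist_fnorm)
    \<comment> \<open>Linearity handles the finite partial sums, and continuity of \<open>A\<close>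
      then passes to \<open>x\<close>. Of the factor 5, one unit comes from the summand at
      \<open>t\<close> and two each from the terms before and after it.\<close>
    have "dist (A (sum z {..<m})) (y p $ j) \<le> 5 * (1/2) ^ p" if m: "m > t" for m
    proof -
      have m_split: "{..<m} = insert t ({..<t} \<union> {t<..<m})" using m by auto
      have "A (sum z {..<m}) = A (z t) + (\<Sum>s\<in>{..<t} \<union> {t<..<m}. A (z s))"
        unfolding A_sum m_split by (rule sum.insert) auto
      also have "(\<Sum>s\<in>{..<t} \<union> {t<..<m}. A (z s))
          = (\<Sum>s<t. A (z s)) + (\<Sum>s\<in>{t<..<m}. A (z s))"
        by (rule sum.union_disjoint) auto
      finally have "A (sum z {..<m}) =
          A (z t) + ((\<Sum>s<t. A (z s)) + (\<Sum>s\<in>{t<..<m}. A (z s)))" .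
      then have error: "A (sum z {..<m}) - y p $ j =
          (A (z t) - y p $ j) + ((\<Sum>s<t. A (z s)) + (\<Sum>s\<in>{t<..<m}. A (z s)))"
        by simp
      have "fnorm (A (sum z {..<m}) - y p $ j) \<le> fnorm (A (z t) - y p $ j)
          + (fnorm (\<Sum>s<t. A (z s)) + fnorm (\<Sum>s\<in>{t<..<m}. A (z s)))"
        unfolding error
        using fnorm_triangle[of "A (z t) - y p $ j"
            "(\<Sum>s<t. A (z s)) + (\<Sum>s\<in>{t<..<m}. A (z s))"]
          fnorm_triangle[of "\<Sum>s<t. A (z s)" "\<Sum>s\<in>{t<..<m}. A (z s)"]
        by linarith
      also have "\<dots> \<le> (1/2) ^ p + (2 * (1/2) ^ p + 2 * (1/2) ^ p)"
        by (intro add_mono at before after) auto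
      finally show ?thesis by (simp add: dist_fnorm)
    qed
    then have bounded: "\<forall>m\<ge>Suc t. dist (A (sum z {..<m})) (y p $ j) \<le> 5 * (1/2) ^ p"
      by auto
    have "(\<lambda>m. A (sum z {..<m})) \<longlonglongrightarrow> A x"
      using continuous_on_funpow[OF continuous[of j], of "n k"]
      unfolding A_def by (rule continuous_on_tendsto_compose[OF _ x]) auto
    then have "(\<lambda>m. dist (A (sum z {..<m})) (y p $ j)) \<longlonglongrightarrow> dist (A x) (y p $ j)"
      by (intro tendsto_dist tendsto_const)
    from Lim_bounded[OF this bounded] show ?thesis
      unfolding A_def k_def p_def .
  qed

  \<comment> \<open>Lower density of the return times\<close>
  obtain B where B: "\<And>k. n k \<le> B * Suc k"
    using linear_growth_of_lower_density_pos[OF increasing density] by blast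
  have "0 < lower_density {n. (\<chi> j. (T j ^^ n) x) \<in> U}"
    if U: "open U" "U \<noteq> {}" for U :: "('a ^ 'n) set"
  proof -
    obtain i where "y0 i \<in> U" using y0_dense[OF U] by blast
    then obtain r where r: "r > 0" "\<And>v. dist v (y0 i) < r \<Longrightarrow> v \<in> U"
      using U(1) by (auto simp: open_dist)
    have "0 < r / (5 * real CARD('n))" using r(1) by simp
    then obtain b where b: "(1/2) ^ b < r / (5 * real CARD('n))"
      using real_arch_pow_inv[of _ "1/2::real"] by fastforce
    \<comment> \<open>The component \<open>i\<close> selects the target, and \<open>b\<close> forces
      \<open>p \<ge> b\<close>, which makes the error small.\<close>
    define p where "p = prod_encode (i, b)"
    have yp: "y p = y0 i" by (simp add: y_def p_def)
    have "(1/2::real) ^ p \<le> (1/2) ^ b"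
      unfolding p_def by (rule power_decreasing) (auto simp: le_prod_encode_2)
    with b have "(1/2) ^ p < r / (5 * real CARD('n))" by linarith
    then have p: "real CARD('n) * (5 * (1/2) ^ p) < r" by (simp add: field_simps)
    have hit: "(\<chi> j. (T j ^^ n (pos t)) x) \<in> U" if t: "colour t = p" for t
    proof (rule r(2))
      let ?v = "\<chi> j. (T j ^^ n (pos t)) x"
      have "dist ?v (y0 i) \<le> (\<Sum>j\<in>UNIV. dist (?v $ j) (y0 i $ j))"
        unfolding dist_vec_def by (rule L2_set_le_sum) simp
      also have "\<dots> \<le> real CARD('n) * (5 * (1/2) ^ p)"
        by (rule sum_bounded_above) (use approx[of t] t yp in auto)
      also have "\<dots> < r" by (rule p)
      finally show "dist ?v (y0 i) < r" .
    qed
    obtain f D where f: "strict_mono f" "\<And>q. colour (f q) = p" "\<And>q. f q \<le> D * Suc q"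
      using fibre[of p] by blast
    \<comment> \<open>\<open>n\<close>, \<open>pos\<close> and \<open>f\<close> are strictly
      increasing of at most linear growth, and so is their composite.\<close>
    define g where "g q = n (pos (f q))" for q
    show ?thesis
    proof (rule lower_density_pos_of_linear_growth)
      show "strict_mono g"
        using increasing pos f(1) by (simp add: g_def strict_mono_def)
      show "range g \<subseteq> {n. (\<chi> j. (T j ^^ n) x) \<in> U}"
        using hit f(2) by (auto simp: g_def)
      show "g q \<le> (B * (1 + C * (1 + D))) * Suc q" for q
      proof -
        have "g q \<le> B * Suc (pos (f q))" unfolding g_def by (rule B)
        also have "\<dots> \<le> B * Suc (C * Suc (f q))" using pos_le by simp
        also have "\<dots> \<le> B * Suc (C * Suc (D * Suc q))" using f(3) by simp
        also have "\<dots> \<le> B * Suc (C * ((1 + D) * Suc q))"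
          by (intro mult_le_mono2 Suc_le_mono[THEN iffD2]) simp
        also have "\<dots> \<le> B * ((1 + C * (1 + D)) * Suc q)"
          by (intro mult_le_mono2) (simp add: algebra_simps)
        finally show ?thesis by (simp only: mult.assoc)
      qed
    qed
  qed
  then show ?thesis unfolding disjointly_frequently_hypercyclic_def by blast
qed

end
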